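(* Let $p$ be an odd prime. Then the following three groups of order $p^3$ all have isomorphic endomorphism digraphs: the cyclic group $\mathbb{Z}_{p^3}$; the group $\mathbb{Z}_{p^2}\times\mathbb{Z}_p$; and the non-abelian group of order $p^3$ and exponent $p^2$.
   Context: The endomorphism digraph of a group $G$ has vertex set $G$, with an arc from $x$ to $y$ if $x\neq y$ and some endomorphism of $G$ maps $x$ to $y$. The non-abelian group of order $p^3$ and exponent $p^2$ (unique up to isomorphism for $p$ odd) is $\langle a,b : a^{p^2}=b^p=e,\ b^{-1}ab=a^{1+p}\rangle$. *)

theory Defs
  imports
    "HOL-Algebra.Elementary_Groups"
    "HOL-Algebra.Multiplicative_Group"
    "HOL-Computational_Algebra.Primes"
    "Graph_Theory.Digraph_Isomorphism"
    "Graph_Theory.Pair_Digraph"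
begin

text \<open>
  The digraph is simple, so its arcs are the ordered pairs of vertices themselves, and
  \<^const>\<open>with_proj\<close> supplies the two projections as tail and head.
\<close>

definition endo_digraph :: "('a, 'm) monoid_scheme \<Rightarrow> ('a, 'a \<times> 'a) pre_digraph" where
  "endo_digraph G = with_proj
     \<lparr> pverts = carrier G,
       parcs = {(x, y). x \<in> carrier G \<and> y \<in> carrier G \<and> x \<noteq> y \<and> (\<exists>f \<in> hom G G. f x = y)} \<rparr>"

text \<open>
  The exponent is meaningful only for groups of finite exponent, in particular for finite
  groups; otherwise the set minimised over is empty and the value is unspecified.
\<close>

definition group_exponent :: "('a, 'm) monoid_scheme \<Rightarrow> nat" where
  "group_exponent G = (LEAST n. 0 < n \<and> (\<forall>x \<in> carrier G. x [^]\<^bsub>G\<^esub> n = \<one>\<^bsub>G\<^esub>))"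

end

theory Submission
  imports Defs "HOL-Number_Theory.Residues"
begin

text \<open>
  In each of the three groups the relation ``some endomorphism maps \<open>x\<close> to \<open>y\<close>'' is
  described by a chain of four subsets of sizes \<open>1, p, p\<^sup>2, p\<^sup>3\<close>: it holds iff \<open>y\<close> lies in
  every member of the chain that contains \<open>x\<close>. Such a relation is determined up to
  isomorphism by the sizes of the members alone (\<open>endo_chain_imp_digraph_iso\<close>), so it
  suffices to exhibit the chains.

  In the cyclic group the chain consists of the subgroups. In the other two groups it is
  \<open>{\<one>} \<subseteq> {x\<^sup>p} \<subseteq> {x. x\<^sup>p = \<one>} \<subseteq> G\<close>. Endomorphisms preserve all
  four sets, and the point is that they preserve nothing more. Both groups have a presentation
  \<open>a\<close> of order \<open>p\<^sup>2\<close>, \<open>b\<close> of order \<open>p\<close>, \<open>b a = a\<^sup>s b\<close> with \<open>s \<equiv> 1\<close> modulo \<open>p\<close>,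
  with \<open>s \<equiv> 1\<close> modulo \<open>p\<^sup>2\<close> in the abelian case (\<open>metacyclic_presentation\<close>); hence pairs
  that satisfy these relations are the images of \<open>(a, b)\<close> under endomorphisms
  (\<open>ex_hom\<close>). As \<open>p\<close> is odd, \<open>(a\<^sup>i b\<^sup>j)\<^sup>p = a\<^sup>i\<^sup>p\<close>, and it follows that conjugation by \<open>b\<close>
  raises \<^emph>\<open>every\<close> element to the power \<open>s\<close> (\<open>b_mult_commute\<close>). So any \<open>x\<close> with
  \<open>x\<^sup>p \<noteq> \<one>\<close> can replace \<open>a\<close> in the presentation, any \<open>y\<close> whatsoever satisfies the relations
  together with \<open>b\<close>, and \<open>x \<mapsto> y, b \<mapsto> b\<close> defines an endomorphism. The elements of the smaller
  sets are dealt with by taking \<open>p\<close>-th powers of such pairs and by the endomorphisms that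
  kill \<open>a\<close>.
\<close>

section \<open>Digraphs of groups whose endomorphisms are governed by a chain\<close>

text \<open>
  The members of the chain need not be subgroups: only their sizes and their nesting enter
  into the shape of the digraph.
\<close>

definition endo_chain :: "('a, 'm) monoid_scheme \<Rightarrow> nat \<Rightarrow> (nat \<Rightarrow> 'a set) \<Rightarrow> bool" where
  "endo_chain G n S \<longleftrightarrow>
     finite (carrier G) \<and> S n = carrier G \<and> (\<forall>k<n. S k \<subseteq> S (Suc k)) \<and>
     (\<forall>x \<in> carrier G. \<forall>y \<in> carrier G.
        (\<exists>f \<in> hom G G. f x = y) \<longleftrightarrow> (\<forall>k\<le>n. x \<in> S k \<longrightarrow> y \<in> S k))"

text \<open>
  Successive differences of the two chains have equal sizes, so a bijection of one level can
  be extended to the next by any bijection of the differences.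
\<close>

lemma bij_betw_chains:
  assumes "finite (S n)" "finite (T n)"
    and "\<forall>k<n. S k \<subseteq> S (Suc k)" "\<forall>k<n. T k \<subseteq> T (Suc k)"
    and "\<forall>k\<le>n. card (S k) = card (T k)"
  shows "\<exists>f. bij_betw f (S n) (T n) \<and> (\<forall>k\<le>n. \<forall>x \<in> S n. f x \<in> T k \<longleftrightarrow> x \<in> S k)"
  using assms
proof (induction n)
  case 0
  then show ?case
    using finite_same_card_bij[of "S 0" "T 0"] by (auto simp: bij_betw_apply)
next
  case (Suc n)
  have sub: "S n \<subseteq> S (Suc n)" "T n \<subseteq> T (Suc n)" using Suc.prems by auto
  have fin: "finite (S n)" "finite (T n)"
    using sub Suc.prems finite_subset by blast+
  obtain f where f: "bij_betw f (S n) (T n)"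
    and fk: "\<And>k x. k \<le> n \<Longrightarrow> x \<in> S n \<Longrightarrow> f x \<in> T k \<longleftrightarrow> x \<in> S k"
    using Suc.IH[OF fin] Suc.prems by auto
  have "card (S (Suc n) - S n) = card (T (Suc n) - T n)"
    using sub fin Suc.prems by (simp add: card_Diff_subset)
  then obtain g where g: "bij_betw g (S (Suc n) - S n) (T (Suc n) - T n)"
    using finite_same_card_bij Suc.prems by (metis finite_Diff)
  define h where "h x = (if x \<in> S n then f x else g x)" for x
  have "bij_betw h (S n \<union> (S (Suc n) - S n)) (T n \<union> (T (Suc n) - T n))"
    unfolding h_def by (rule bij_betw_disjoint_Un[OF f g]) auto
  then have h: "bij_betw h (S (Suc n)) (T (Suc n))"
    using sub by (simp add: Un_absorb1)
  have mono: "S k \<subseteq> S n \<and> T k \<subseteq> T n" if "k \<le> n" for k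
    using that
  proof (induction rule: inc_induct)
    case (step k)
    then have "S k \<subseteq> S (Suc k)" "T k \<subseteq> T (Suc k)" using Suc.prems by auto
    then show ?case using step.IH by blast
  qed simp
  have "h x \<in> T k \<longleftrightarrow> x \<in> S k" if "k \<le> Suc n" "x \<in> S (Suc n)" for k x
  proof (cases "k = Suc n")
    case True
    then show ?thesis using that h by (auto simp: bij_betw_apply)
  next
    case False
    then have k: "k \<le> n" using that by simp
    show ?thesis
    proof (cases "x \<in> S n")
      case True
      then show ?thesis using fk k by (simp add: h_def)
    next
      case False
      then have "g x \<in> T (Suc n) - T n" using that by (intro bij_betw_apply[OF g]) simp
      then show ?thesis using False mono[OF k] by (auto simp: h_def)
    qed
  qed
  with h show ?case by blast
qed

lemma digraph_iso_endo_digraphI: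
  assumes f: "bij_betw f (carrier G) (carrier H)"
    and arc: "\<And>x y. x \<in> carrier G \<Longrightarrow> y \<in> carrier G \<Longrightarrow>
      (\<exists>\<phi> \<in> hom H H. \<phi> (f x) = f y) \<longleftrightarrow> (\<exists>\<phi> \<in> hom G G. \<phi> x = y)"
  shows "digraph_iso (endo_digraph G) (endo_digraph H)"
proof -
  define F where "F = \<lparr>iso_verts = f, iso_arcs = map_prod f f, iso_head = snd, iso_tail = fst\<rparr>"
  have inj: "inj_on f (carrier G)" and im: "f ` carrier G = carrier H"
    using f by (auto simp: bij_betw_def)
  have "arcs (endo_digraph H) = map_prod f f ` arcs (endo_digraph G)" (is "?A = ?B")
  proof
    show "?B \<subseteq> ?A"
      using arc im by (auto simp: endo_digraph_def dest: inj_onD[OF inj])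
    show "?A \<subseteq> ?B"
    proof
      fix e assume "e \<in> ?A"
      then obtain u v \<phi> where e: "e = (u, v)" "u \<in> carrier H" "v \<in> carrier H" "u \<noteq> v"
        and \<phi>: "\<phi> \<in> hom H H" "\<phi> u = v"
        by (auto simp: endo_digraph_def)
      obtain x y where xy: "x \<in> carrier G" "u = f x" "y \<in> carrier G" "v = f y"
        using e im by blast
      then have "\<exists>\<psi> \<in> hom G G. \<psi> x = y" using arc \<phi> by blast
      then have "(x, y) \<in> arcs (endo_digraph G)"
        using xy e by (auto simp: endo_digraph_def)
      then show "e \<in> ?B" using xy e by force
    qed
  qed
  then have "endo_digraph H = app_iso F (endo_digraph G)"
    using im by (intro pre_digraph.equality) (auto simp: F_def endo_digraph_def with_proj_def)
  moreover have "pre_digraph.digraph_isomorphism (endo_digraph G) F"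
    unfolding pre_digraph.digraph_isomorphism_def
  proof (intro conjI)
    show "wf_digraph (endo_digraph G)"
      by unfold_locales (auto simp: endo_digraph_def)
    show "inj_on (iso_verts F) (verts (endo_digraph G))"
      using inj by (simp add: F_def endo_digraph_def)
    have "inj_on (map_prod f f) (carrier G \<times> carrier G)"
      using inj by (simp add: map_prod_inj_on)
    moreover have "arcs (endo_digraph G) \<subseteq> carrier G \<times> carrier G"
      by (auto simp: endo_digraph_def)
    ultimately show "inj_on (iso_arcs F) (arcs (endo_digraph G))"
      unfolding F_def by (simp add: inj_on_subset)
  qed (auto simp: F_def endo_digraph_def)
  ultimately show ?thesis unfolding digraph_iso_def by blast
qed

lemma endo_chain_imp_digraph_iso:
  assumes G: "endo_chain G n S" and H: "endo_chain H n T"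
    and card: "\<And>k. k \<le> n \<Longrightarrow> card (S k) = card (T k)"
  shows "digraph_iso (endo_digraph G) (endo_digraph H)"
proof -
  have top: "S n = carrier G" "T n = carrier H" using G H by (auto simp: endo_chain_def)
  obtain f where f: "bij_betw f (S n) (T n)"
    and fk: "\<And>k x. k \<le> n \<Longrightarrow> x \<in> S n \<Longrightarrow> f x \<in> T k \<longleftrightarrow> x \<in> S k"
    using bij_betw_chains[of S n T] assms by (auto simp: endo_chain_def)
  show ?thesis
  proof (rule digraph_iso_endo_digraphI)
    show "bij_betw f (carrier G) (carrier H)" using f top by simp
    fix x y assume xy: "x \<in> carrier G" "y \<in> carrier G"
    then have "f x \<in> carrier H" "f y \<in> carrier H" using f top by (auto simp: bij_betw_apply)
    then have "(\<exists>\<phi> \<in> hom H H. \<phi> (f x) = f y) \<longleftrightarrow> (\<forall>k\<le>n. f x \<in> T k \<longrightarrow> f y \<in> T k)"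
      using H by (simp add: endo_chain_def)
    also have "\<dots> \<longleftrightarrow> (\<forall>k\<le>n. x \<in> S k \<longrightarrow> y \<in> S k)"
      using fk xy top by auto
    also have "\<dots> \<longleftrightarrow> (\<exists>\<phi> \<in> hom G G. \<phi> x = y)"
      using G xy by (simp add: endo_chain_def)
    finally show "(\<exists>\<phi> \<in> hom H H. \<phi> (f x) = f y) \<longleftrightarrow> (\<exists>\<phi> \<in> hom G G. \<phi> x = y)" .
  qed
qed

section \<open>Cyclic groups of prime power order\<close>

text \<open>
  For \<open>k \<le> n\<close> this is the subgroup of order \<open>p ^ k\<close> of the integers modulo \<open>p ^ n\<close>.
\<close>

definition multiples_chain :: "nat \<Rightarrow> nat \<Rightarrow> nat \<Rightarrow> int set" where
  "multiples_chain p n k = {x \<in> {0..<int p ^ n}. int p ^ (n - k) dvd x}"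

lemma card_multiples_chain:
  assumes "0 < p" "k \<le> n"
  shows "card (multiples_chain p n k) = p ^ k"
proof -
  have split: "int p ^ n = int p ^ (n - k) * int p ^ k"
    using assms by (simp flip: power_add)
  have "multiples_chain p n k = (*) (int p ^ (n - k)) ` {0..<int p ^ k}"
  proof (intro equalityI subsetI)
    fix x assume "x \<in> multiples_chain p n k"
    then obtain y where y: "x = int p ^ (n - k) * y" and "0 \<le> x" "x < int p ^ (n - k) * int p ^ k"
      using split by (auto simp: multiples_chain_def)
    moreover have "0 < int p ^ (n - k)" using assms by simp
    ultimately have "0 \<le> y" "y < int p ^ k"
      by (simp_all add: zero_le_mult_iff)
    then show "x \<in> (*) (int p ^ (n - k)) ` {0..<int p ^ k}" using y by auto
  next
    fix x assume "x \<in> (*) (int p ^ (n - k)) ` {0..<int p ^ k}"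
    then show "x \<in> multiples_chain p n k"
      using assms split by (auto simp: multiples_chain_def)
  qed
  moreover have "inj_on ((*) (int p ^ (n - k))) {0..<int p ^ k}"
    using assms by (auto simp: inj_on_def)
  ultimately show ?thesis by (simp add: card_image flip: of_nat_power)
qed

lemma gcd_prime_power:
  fixes p :: nat
  assumes "prime p"
  obtains k where "k \<le> n" "gcd x (int p ^ n) = int p ^ (n - k)"
proof -
  have "nat (gcd x (int p ^ n)) dvd p ^ n"
    by (metis gcd_dvd2 gcd_ge_0_int int_dvd_int_iff int_nat_eq of_nat_power)
  then obtain i where "i \<le> n" "nat (gcd x (int p ^ n)) = p ^ i"
    using divides_primepow_nat[OF assms] by blast
  then have "gcd x (int p ^ n) = int p ^ (n - (n - i))"
    by (metis diff_diff_cancel gcd_ge_0_int int_nat_eq of_nat_power)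
  then show thesis using that[of "n - i"] by simp
qed

text \<open>
  The subgroup of order \<open>p ^ k\<close> is the kernel of the \<open>p ^ k\<close>-th power map, so endomorphisms
  preserve it. Conversely, if \<open>y\<close> lies in the smallest member that contains \<open>x\<close>, then
  \<open>gcd x (p ^ n)\<close> divides \<open>y\<close>, so \<open>y\<close> is a multiple of \<open>x\<close> modulo \<open>p ^ n\<close>, and multiplication by
  the cofactor is an endomorphism.
\<close>

lemma endo_chain_integer_mod_group:
  fixes p :: nat
  assumes p: "prime p"
  shows "endo_chain (integer_mod_group (p ^ n)) n (multiples_chain p n)"
proof -
  let ?G = "integer_mod_group (p ^ n)"
  have p0: "0 < p" using p by (simp add: prime_gt_0_nat)
  have car: "carrier ?G = {0..<int p ^ n}" using p0 by (simp add: carrier_integer_mod_group)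
  have reach: "(\<exists>f \<in> hom ?G ?G. f x = y) \<longleftrightarrow>
      (\<forall>k\<le>n. x \<in> multiples_chain p n k \<longrightarrow> y \<in> multiples_chain p n k)"
    if xy: "x \<in> carrier ?G" "y \<in> carrier ?G" for x y
  proof
    assume "\<exists>f \<in> hom ?G ?G. f x = y"
    then obtain f where f: "f \<in> hom ?G ?G" "f x = y" by blast
    show "\<forall>k\<le>n. x \<in> multiples_chain p n k \<longrightarrow> y \<in> multiples_chain p n k"
    proof (intro allI impI)
      fix k assume k: "k \<le> n" and "x \<in> multiples_chain p n k"
      then have dvd: "int p ^ (n - k) dvd x" by (simp add: multiples_chain_def)
      have split: "int p ^ n = int p ^ k * int p ^ (n - k)"
        using k by (simp flip: power_add)
      have "x [^]\<^bsub>?G\<^esub> (p ^ k) = \<one>\<^bsub>?G\<^esub>"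
        using dvd split by simp
      then have "y [^]\<^bsub>?G\<^esub> (p ^ k) = \<one>\<^bsub>?G\<^esub>"
        using f xy by (metis hom_nat_pow hom_one group_integer_mod_group)
      then have "int p ^ n dvd int p ^ k * y" by (simp add: mod_eq_0_iff_dvd)
      then have "int p ^ (n - k) dvd y" using split p0 by simp
      then show "y \<in> multiples_chain p n k" using xy car by (simp add: multiples_chain_def)
    qed
  next
    assume chain: "\<forall>k\<le>n. x \<in> multiples_chain p n k \<longrightarrow> y \<in> multiples_chain p n k"
    obtain k where k: "k \<le> n" "gcd x (int p ^ n) = int p ^ (n - k)"
      using gcd_prime_power[OF p] .
    then have "int p ^ (n - k) dvd x" by (metis gcd_dvd1)
    then have "y \<in> multiples_chain p n k"
      using chain k xy car by (simp add: multiples_chain_def)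
    then have "gcd x (int p ^ n) dvd y" using k by (simp add: multiples_chain_def)
    then obtain c where c: "[x * c = y] (mod int p ^ n)"
      by (metis cong_solve_dvd_int)
    show "\<exists>f \<in> hom ?G ?G. f x = y"
    proof
      show "(\<lambda>t. c * t mod int p ^ n) \<in> hom ?G ?G"
        using p0 by (auto simp: hom_def car mod_simps distrib_left)
      show "c * x mod int p ^ n = y"
        using c xy car by (simp add: cong_def mult.commute)
    qed
  qed
  have "int p ^ (n - Suc k) dvd int p ^ (n - k)" for k
    by (simp add: le_imp_power_dvd)
  then have "multiples_chain p n k \<subseteq> multiples_chain p n (Suc k)" for k
    unfolding multiples_chain_def using dvd_trans by blast
  then show ?thesis
    using reach by (auto simp: endo_chain_def car) (auto simp: multiples_chain_def)
qed

section \<open>Powers in metacyclic groups\<close>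

text \<open>
  Writing \<open>s ^ j = 1 + p n\<close>, the terms are \<open>1 + p n t\<close> modulo \<open>p\<^sup>2\<close>, so the sum exceeds \<open>p\<close> by
  \<open>p n\<close> times \<open>0 + 1 + \<dots> + (p - 1)\<close>. That last sum is a multiple of \<open>p\<close> because \<open>p\<close> is odd.
\<close>

lemma cong_sum_powers_one_plus:
  fixes p s j :: nat
  assumes "odd p" and s: "[s = 1] (mod p)"
  shows "[(\<Sum>t<p. s ^ (j * t)) = p] (mod p\<^sup>2)"
proof -
  have "[s ^ j = 1] (mod p)" using cong_pow[OF s, of j] by simp
  then have "[int s ^ j = 1] (mod int p)" by (metis cong_int_iff of_nat_1 of_nat_power)
  then obtain n where n: "int s ^ j = 1 + int p * n"
    by (metis add.commute cong_iff_lin mult.commute cong_sym)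
  have pow: "[(1 + int p * n) ^ t = 1 + int p * n * int t] (mod int p ^ 2)" for t
  proof (induction t)
    case (Suc t)
    have "[(1 + int p * n) ^ Suc t = (1 + int p * n) * (1 + int p * n * int t)] (mod int p ^ 2)"
      using Suc by (simp add: cong_scalar_left)
    moreover have "(1 + int p * n) * (1 + int p * n * int t)
        = (1 + int p * n * int (Suc t)) + int p ^ 2 * (n\<^sup>2 * int t)"
      by (simp add: algebra_simps power2_eq_square)
    ultimately show ?case by (simp add: cong_def)
  qed simp
  have gauss: "(\<Sum>t<p. int t) = int p * ((int p - 1) div 2)"
  proof -
    obtain q where q: "p = 2 * q + 1" using \<open>odd p\<close> by (rule oddE)
    have "2 * (\<Sum>t<k. int t) = int k * (int k - 1)" for k :: nat
      by (induction k) (auto simp: algebra_simps)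
    from this[of p] show ?thesis using q by simp
  qed
  have "int (\<Sum>t<p. s ^ (j * t)) = (\<Sum>t<p. (1 + int p * n) ^ t)"
    using n by (simp add: power_mult)
  also have "[\<dots> = (\<Sum>t<p. 1 + int p * n * int t)] (mod int p ^ 2)"
    by (intro cong_sum pow)
  also have "(\<Sum>t<p. 1 + int p * n * int t) = int p + int p ^ 2 * (n * ((int p - 1) div 2))"
    by (simp add: sum.distrib gauss power2_eq_square mult.assoc mult.left_commute
        flip: sum_distrib_left)
  also have "[\<dots> = int p] (mod int p ^ 2)" by (simp add: cong_def)
  finally show ?thesis by (metis cong_int_iff of_nat_power)
qed

context group
begin

lemma nat_pow_in_subgroup:
  assumes "subgroup H G" "h \<in> H"
  shows "h [^] (k::nat) \<in> H"
  using subgroup_int_pow_closed[OF assms, of "int k"] by (simp add: int_pow_int)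

lemma pow_cong:
  assumes "x \<in> carrier G" "x [^] (n::nat) = \<one>" "[i = k] (mod n)"
  shows "x [^] (i::nat) = x [^] k"
proof -
  have "x [^] i = x [^] (i mod n)" for i :: nat
  proof -
    have "x [^] i = x [^] (n * (i div n) + i mod n)" by simp
    also have "\<dots> = (x [^] n) [^] (i div n) \<otimes> x [^] (i mod n)"
      by (simp only: nat_pow_mult[OF assms(1)] nat_pow_pow[OF assms(1)])
    also have "\<dots> = x [^] (i mod n)" using assms by simp
    finally show ?thesis .
  qed
  from this[of i] this[of k] show ?thesis using assms by (simp add: cong_def)
qed

lemma metacyclic_commute:
  assumes "c \<in> carrier G" "d \<in> carrier G" and "d \<otimes> c = c [^] (s::nat) \<otimes> d"
  shows "d [^] (j::nat) \<otimes> c [^] (k::nat) = c [^] (k * s ^ j) \<otimes> d [^] j"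
proof -
  have one: "d \<otimes> c [^] k = c [^] (k * s) \<otimes> d" for k :: nat
  proof (induction k)
    case (Suc k)
    have "d \<otimes> c [^] Suc k = (d \<otimes> c [^] k) \<otimes> c" using assms by (simp add: m_assoc)
    also have "\<dots> = c [^] (k * s) \<otimes> (c [^] s \<otimes> d)"
      using Suc assms by (simp add: m_assoc)
    also have "\<dots> = c [^] (Suc k * s) \<otimes> d"
      using assms by (simp add: nat_pow_mult add.commute flip: m_assoc)
    finally show ?case .
  qed (use assms in simp)
  show ?thesis
  proof (induction j arbitrary: k)
    case (Suc j)
    have "d [^] Suc j \<otimes> c [^] k = d [^] j \<otimes> (d \<otimes> c [^] k)" using assms by (simp add: m_assoc)
    also have "\<dots> = (d [^] j \<otimes> c [^] (k * s)) \<otimes> d" using one assms by (simp add: m_assoc)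
    also have "\<dots> = c [^] (k * s * s ^ j) \<otimes> d [^] j \<otimes> d" using Suc by simp
    also have "\<dots> = c [^] (k * s ^ Suc j) \<otimes> d [^] Suc j"
      using assms by (simp add: m_assoc mult.assoc)
    finally show ?case .
  qed (use assms in simp)
qed

text \<open>
  The multiplication table that the relation \<open>d c = c\<^sup>s d\<close> forces on normal forms; it depends
  on nothing but \<open>s\<close>, which is what makes maps between such pairs homomorphisms.
\<close>

lemma metacyclic_mult:
  assumes "c \<in> carrier G" "d \<in> carrier G" and "d \<otimes> c = c [^] (s::nat) \<otimes> d"
  shows "(c [^] (i::nat) \<otimes> d [^] (j::nat)) \<otimes> (c [^] (k::nat) \<otimes> d [^] (l::nat))
    = c [^] (i + k * s ^ j) \<otimes> d [^] (j + l)"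
proof -
  have "(c [^] i \<otimes> d [^] j) \<otimes> (c [^] k \<otimes> d [^] l) = c [^] i \<otimes> (d [^] j \<otimes> c [^] k) \<otimes> d [^] l"
    using assms by (simp add: m_assoc)
  also have "\<dots> = (c [^] i \<otimes> c [^] (k * s ^ j)) \<otimes> (d [^] j \<otimes> d [^] l)"
    using assms by (simp add: metacyclic_commute m_assoc)
  finally show ?thesis using assms by (simp add: nat_pow_mult)
qed

lemma metacyclic_pow:
  assumes "c \<in> carrier G" "d \<in> carrier G" and "d \<otimes> c = c [^] (s::nat) \<otimes> d"
  shows "(c [^] (i::nat) \<otimes> d [^] (j::nat)) [^] (n::nat)
    = c [^] (i * (\<Sum>t<n. s ^ (j * t))) \<otimes> d [^] (j * n)"
proof (induction n)
  case (Suc n)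
  then show ?case using assms
    by (simp add: metacyclic_mult algebra_simps)
qed simp

end

section \<open>A presentation of the groups of order $p^3$ and exponent $p^2$\<close>

locale p_cubed_group = group +
  fixes p :: nat
  assumes prime_p: "prime p" and odd_p: "odd p"
    and order_G: "order G = p ^ 3"
    and pow_p2: "x \<in> carrier G \<Longrightarrow> x [^] p\<^sup>2 = \<one>"
begin

lemma p_pos [simp]: "0 < p" using prime_p by (rule prime_gt_0_nat)

lemma finite_carrier: "finite (carrier G)"
  using order_G p_pos order_gt_0_iff_finite by simp

text \<open>
  The exponent of \<open>c\<close> is \<open>i\<close> times a sum of powers of \<open>s\<close> that is \<open>p\<close> modulo \<open>p\<^sup>2\<close>, and only
  its residue modulo \<open>p\<^sup>2\<close> matters.
\<close>

lemma metacyclic_pow_p: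
  assumes "c \<in> carrier G" "d \<in> carrier G" "d \<otimes> c = c [^] (s::nat) \<otimes> d" "[s = 1] (mod p)"
  shows "(c [^] (i::nat) \<otimes> d [^] (j::nat)) [^] p = c [^] (i * p) \<otimes> d [^] (j * p)"
proof -
  have "[i * (\<Sum>t<p. s ^ (j * t)) = i * p] (mod p\<^sup>2)"
    using cong_sum_powers_one_plus[OF odd_p] assms by (simp add: cong_scalar_left)
  then have "c [^] (i * (\<Sum>t<p. s ^ (j * t))) = c [^] (i * p)"
    by (rule pow_cong[OF assms(1) pow_p2[OF assms(1)]])
  then show ?thesis by (simp only: metacyclic_pow[OF assms(1-3)])
qed

lemma inverse_mod_p2:
  assumes "\<not> p dvd e"
  obtains e' where "[e * e' = 1] (mod p\<^sup>2)"
proof -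
  have "coprime e (p\<^sup>2)" using prime_imp_coprime[OF prime_p assms] by (simp add: ac_simps)
  then show thesis using cong_solve_coprime_nat that by (metis One_nat_def)
qed


lemma ord_eq_p2:
  assumes a: "a \<in> carrier G" "a [^] p \<noteq> \<one>"
  shows "ord a = p\<^sup>2"
proof -
  have "ord a dvd p ^ 2" using pow_p2 a pow_eq_id by blast
  then obtain i where i: "i \<le> 2" "ord a = p ^ i"
    using divides_primepow_nat[OF prime_p] by blast
  have "\<not> i \<le> 1"
    using a i le_imp_power_dvd[of i 1 p] pow_eq_id[of a p] by auto
  then have "i = 2" using i by linarith
  then show ?thesis using i by simp
qed

lemma pow_eq_iff:
  assumes a: "a \<in> carrier G" "a [^] p \<noteq> \<one>"
  shows "a [^] (i::nat) = a [^] (k::nat) \<longleftrightarrow> [i = k] (mod p\<^sup>2)"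
proof -
  have "a [^] i = a [^] k \<longleftrightarrow> a [^] int i = a [^] int k" by (simp add: int_pow_int)
  also have "\<dots> \<longleftrightarrow> [int k = int i] (mod int (p\<^sup>2))"
    using a by (simp add: int_pow_eq ord_eq_p2 cong_iff_dvd_diff)
  finally show ?thesis by (metis cong_int_iff cong_sym)
qed

lemma mem_generate_iff:
  assumes "a \<in> carrier G"
  shows "x \<in> generate G {a} \<longleftrightarrow> (\<exists>i::nat. x = a [^] i)"
  using generate_pow_on_finite_carrier[OF finite_carrier assms] by auto

text \<open>
  An exponent prime to \<open>p\<close> is invertible modulo \<open>p\<^sup>2\<close>, so \<open>x\<close> is itself a power of \<open>x [^] e\<close>.
\<close>

lemma root_in_subgroup:
  assumes H: "subgroup H G" and x: "x \<in> carrier G" and e: "x [^] (e::nat) \<in> H" "\<not> p dvd e"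
  shows "x \<in> H"
proof -
  obtain e' where "[e * e' = 1] (mod p\<^sup>2)" using inverse_mod_p2 e by blast
  then have "(x [^] e) [^] e' = x [^] (1::nat)"
    using x pow_cong[OF x pow_p2] by (simp only: nat_pow_pow)
  then have "x = (x [^] e) [^] e'" using x by simp
  then show ?thesis using nat_pow_in_subgroup[OF H] e by metis
qed

text \<open>
  A counting argument that stands in for the index of \<open>\<langle>a\<rangle>\<close>: the \<open>p\<^sup>2 * p\<close> products with
  \<open>i < p\<^sup>2\<close> and \<open>j < p\<close> are distinct, since a coincidence would put a power of \<open>d\<close> with an
  exponent prime to \<open>p\<close>, and hence \<open>d\<close>, into \<open>\<langle>a\<rangle>\<close>. So they exhaust the group.
\<close>

lemma cyclic_times_powers:
  assumes a: "a \<in> carrier G" "a [^] p \<noteq> \<one>" and d: "d \<in> carrier G" "d \<notin> generate G {a}"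
    and x: "x \<in> carrier G"
  obtains i j :: nat where "x = a [^] i \<otimes> d [^] j"
proof -
  let ?f = "\<lambda>(i, j). a [^] i \<otimes> d [^] j" and ?A = "{..<p\<^sup>2} \<times> {..<p}"
  have H: "subgroup (generate G {a}) G" using a by (intro generate_is_subgroup) simp
  have le: "l \<le> j" if "l < p" and eq: "a [^] i \<otimes> d [^] j = a [^] k \<otimes> d [^] l" for i j k l :: nat
  proof (rule ccontr)
    assume "\<not> l \<le> j"
    then have "d [^] l = d [^] (l - j) \<otimes> d [^] j" using d by (simp add: nat_pow_mult)
    then have "a [^] i \<otimes> d [^] j = (a [^] k \<otimes> d [^] (l - j)) \<otimes> d [^] j"
      using eq a d by (simp add: m_assoc)
    then have "a [^] i = a [^] k \<otimes> d [^] (l - j)"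
      using a d by simp
    then have "d [^] (l - j) = inv (a [^] k) \<otimes> a [^] i"
      using a d by (simp add: m_assoc[symmetric])
    then have "d [^] (l - j) \<in> generate G {a}"
      using a H mem_generate_iff
      by (metis subgroup.m_closed subgroup.m_inv_closed)
    moreover have "\<not> p dvd l - j" using \<open>\<not> l \<le> j\<close> that by (auto dest: dvd_imp_le)
    ultimately show False using root_in_subgroup[OF H] d by blast
  qed
  have "inj_on ?f ?A"
  proof (rule inj_onI, clarify)
    fix i j k l :: nat
    assume lt: "i < p\<^sup>2" "j < p" "k < p\<^sup>2" "l < p"
      and eq: "a [^] i \<otimes> d [^] j = a [^] k \<otimes> d [^] l"
    then have "j = l" using le[OF _ eq] le[OF _ eq[symmetric]] by simp
    with eq a d have "a [^] i = a [^] k" by simp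
    then have "i = k" using pow_eq_iff[OF a] lt by (simp add: cong_def)
    with \<open>j = l\<close> show "i = k \<and> j = l" by simp
  qed
  then have "card (?f ` ?A) = order G"
    by (simp add: card_image order_G power2_eq_square power3_eq_cube)
  moreover have "?f ` ?A \<subseteq> carrier G" using a d by auto
  ultimately have "?f ` ?A = carrier G"
    using finite_carrier by (simp add: card_subset_eq order_def)
  then have "x \<in> ?f ` ?A" using x by simp
  then obtain i j :: nat where "x = a [^] i \<otimes> d [^] j" by auto
  then show thesis by (rule that)
qed

text \<open>
  Normality of \<open>\<langle>a\<rangle>\<close>. If the conjugate \<open>a'\<close> of \<open>a\<close> by \<open>g\<close> were outside \<open>\<langle>a\<rangle>\<close>, every element
  would be a product of powers of \<open>a\<close> and \<open>a'\<close>. Applied to the inverse of \<open>g\<close>, cancelling it on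
  the right leaves \<open>\<one> = a\<^sup>i g a\<^sup>j\<close>, which places \<open>g\<close>, and so \<open>a'\<close>, in \<open>\<langle>a\<rangle>\<close>.
\<close>

lemma conj_in_cyclic:
  assumes a: "a \<in> carrier G" "a [^] p \<noteq> \<one>" and g: "g \<in> carrier G"
  shows "g \<otimes> a \<otimes> inv g \<in> generate G {a}"
proof (rule ccontr)
  let ?H = "generate G {a}"
  assume no: "g \<otimes> a \<otimes> inv g \<notin> ?H"
  have H: "subgroup ?H G" using a by (intro generate_is_subgroup) simp
  interpret H: subgroup ?H G by (rule H)
  have conj: "(g \<otimes> a \<otimes> inv g) [^] j = g \<otimes> a [^] j \<otimes> inv g" for j :: nat
    using a g by (induction j) (simp_all add: m_assoc inv_solve_left')
  obtain i j :: nat where "inv g = a [^] i \<otimes> (g \<otimes> a \<otimes> inv g) [^] j"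
    using cyclic_times_powers[OF a _ no, of "inv g"] a g by auto
  then have "inv g = a [^] i \<otimes> (g \<otimes> a [^] j \<otimes> inv g)" by (simp only: conj)
  then have "\<one> \<otimes> inv g = (a [^] i \<otimes> g \<otimes> a [^] j) \<otimes> inv g"
    using a g by (simp add: m_assoc)
  then have "\<one> = a [^] i \<otimes> g \<otimes> a [^] j" using a g by (simp only: right_cancel m_closed nat_pow_closed one_closed inv_closed)
  then have "g = inv (a [^] i) \<otimes> inv (a [^] j)"
    using a g by (metis inv_solve_left inv_solve_right l_one m_closed nat_pow_closed one_closed inv_closed r_one)
  then have "g \<in> ?H" using mem_generate_iff a by (metis H.m_closed H.m_inv_closed)
  moreover have "a \<in> ?H" by (simp add: generate.incl)
  ultimately show False using no by simp
qed

text \<open>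
  Take \<open>g\<close> outside \<open>\<langle>a\<rangle>\<close>; it acts on \<open>\<langle>a\<rangle>\<close> by some exponent \<open>s\<close>, and its \<open>p\<close>-th power
  \<open>a\<^sup>r\<close> commutes with \<open>a\<close>, so \<open>s\<^sup>p \<equiv> 1\<close> and \<open>s \<equiv> 1\<close> modulo \<open>p\<close> by Fermat. The exponent
  \<open>p\<^sup>2\<close> forces \<open>p\<close> to divide \<open>r\<close>, so multiplying \<open>g\<close> by a suitable power of \<open>a\<close> cancels its
  \<open>p\<close>-th power, because \<open>p\<close>-th powers are computed componentwise.
\<close>

lemma metacyclic_presentation:
  assumes a: "a \<in> carrier G" "a [^] p \<noteq> \<one>"
  obtains b and s :: nat where "b \<in> carrier G" "b [^] p = \<one>" "b \<otimes> a = a [^] s \<otimes> b" "[s = 1] (mod p)"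
    "\<And>x. x \<in> carrier G \<Longrightarrow> \<exists>(i::nat) (j::nat). x = a [^] i \<otimes> b [^] j"
proof -
  let ?H = "generate G {a}"
  have H: "subgroup ?H G" using a by (intro generate_is_subgroup) simp
  interpret H: subgroup ?H G by (rule H)
  have "card ?H = p\<^sup>2" using ord_eq_p2 a generate_pow_card by metis
  moreover have "p\<^sup>2 \<noteq> p ^ 3" using prime_gt_1_nat[OF prime_p] by (simp add: power_inject_exp)
  ultimately have "?H \<noteq> carrier G" using order_G by (auto simp: order_def)
  then obtain g where g: "g \<in> carrier G" "g \<notin> ?H" using H.subset by blast
  obtain s :: nat where "g \<otimes> a \<otimes> inv g = a [^] s"
    using conj_in_cyclic[OF a g(1)] mem_generate_iff a by blast
  then have ga: "g \<otimes> a = a [^] s \<otimes> g" using a g by (simp add: inv_solve_right')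
  have "g [^] p \<in> ?H"
  proof (rule ccontr)
    assume "g [^] p \<notin> ?H"
    then obtain i j :: nat where ij: "g = a [^] i \<otimes> (g [^] p) [^] j"
      using cyclic_times_powers[OF a, of "g [^] p" g] g by auto
    \<comment> \<open>Then \<open>g * g ^ e\<close> lies in \<open>\<langle>a\<rangle>\<close>, where \<open>e \<equiv> - p j\<close> modulo \<open>p\<^sup>2\<close>, yet \<open>1 + e\<close> is prime to \<open>p\<close>.\<close>
    define e where "e = (p\<^sup>2 - p) * j"
    have "p + (p\<^sup>2 - p) = p\<^sup>2" by (simp add: power2_eq_square le_square)
    then have pe: "p * j + e = p\<^sup>2 * j" by (simp add: e_def flip: distrib_right)
    have "(g [^] p) [^] j \<otimes> g [^] e = g [^] (p\<^sup>2 * j)"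
      using g pe by (simp add: nat_pow_mult nat_pow_pow)
    also have "\<dots> = \<one>" using pow_p2[OF g(1)] g by (simp flip: nat_pow_pow)
    finally have "g \<otimes> g [^] e = a [^] i"
      using ij a g by (metis m_assoc nat_pow_closed r_one)
    then have "g [^] Suc e \<in> ?H"
      using mem_generate_iff a g by (metis nat_pow_Suc2)
    moreover have "p dvd e" by (simp add: e_def power2_eq_square flip: right_diff_distrib')
    then have "\<not> p dvd Suc e"
      using prime_p by (metis dvd_add_right_iff not_prime_unit plus_1_eq_Suc add.commute)
    ultimately show False using root_in_subgroup[OF H] g by blast
  qed
  then obtain r :: nat where r: "g [^] p = a [^] r" using mem_generate_iff a by blast
  have "a [^] (r * p) = g [^] (p * p)" using r a g by (simp flip: nat_pow_pow)
  also have "\<dots> = a [^] (0::nat)" using pow_p2 g by (simp flip: power2_eq_square)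
  finally have "[r * p = 0] (mod p\<^sup>2)" using pow_eq_iff a by blast
  then obtain r' where r': "r = p * r'"
    by (auto simp: cong_0_iff power2_eq_square)
  have "a [^] (s ^ p) \<otimes> g [^] p = g [^] p \<otimes> a"
    using metacyclic_commute[OF a(1) g(1) ga, of p 1] a by simp
  also have "\<dots> = a \<otimes> g [^] p" using a r by (metis nat_pow_Suc nat_pow_Suc2)
  finally have "a [^] (s ^ p) = a [^] (1::nat)" using a g by simp
  then have "[s ^ p = 1] (mod p\<^sup>2)" using pow_eq_iff a by blast
  then have sp: "[s ^ p = 1] (mod p)" by (rule cong_dvd_modulus_nat) simp
  have p1: "s ^ p = s * s ^ (p - 1)" using p_pos by (metis power_eq_if less_not_refl)
  have "\<not> p dvd s"
  proof
    assume "p dvd s"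
    then have "[0 = (1::nat)] (mod p)"
      using sp p1 by (metis cong_0_iff cong_sym cong_trans dvd_mult2)
    then show False using prime_gt_1_nat[OF prime_p] by (simp add: cong_def)
  qed
  then have "[s * s ^ (p - 1) = s * 1] (mod p)"
    by (intro cong_scalar_left fermat_theorem prime_p)
  then have s: "[s = 1] (mod p)" using sp p1 by (metis cong_sym cong_trans mult.right_neutral)
  \<comment> \<open>The exponent is \<open>- r'\<close> modulo \<open>p\<close>, so that the \<open>p\<close>-th power cancels \<open>g\<^sup>p = a [^] (p * r')\<close>.\<close>
  define b where "b = a [^] ((p - 1) * r') \<otimes> g"
  have bc: "b \<in> carrier G" using a g by (simp add: b_def)
  have "b [^] p = a [^] ((p - 1) * r' * p) \<otimes> g [^] p"
    using metacyclic_pow_p[OF a(1) g(1) ga s, of "(p - 1) * r'" 1] g by (simp add: b_def)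
  also have "\<dots> = a [^] ((p - 1) * r' * p + p * r')" using r r' a by (simp add: nat_pow_mult)
  also have "(p - 1) * r' * p + p * r' = p\<^sup>2 * r'"
    using p_pos by (cases p) (simp_all add: power2_eq_square algebra_simps)
  also have "a [^] (p\<^sup>2 * r') = \<one>" using pow_p2 a by (simp flip: nat_pow_pow)
  finally have bp: "b [^] p = \<one>" .
  have "b \<otimes> a = a [^] ((p - 1) * r') \<otimes> (a [^] s \<otimes> g)" using ga a g by (simp add: b_def m_assoc)
  also have "\<dots> = a [^] s \<otimes> b"
    using a g by (simp add: b_def nat_pow_comm flip: m_assoc)
  finally have ba: "b \<otimes> a = a [^] s \<otimes> b" .
  have "b \<notin> ?H"
  proof
    assume "b \<in> ?H"
    moreover have "g = inv (a [^] ((p - 1) * r')) \<otimes> b" using a g by (simp add: b_def inv_solve_left)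
    ultimately have "g \<in> ?H" using mem_generate_iff a by (metis H.m_closed H.m_inv_closed)
    then show False using g by simp
  qed
  then show thesis
    using that[OF bc bp ba s] cyclic_times_powers[OF a bc] by metis
qed

end

section \<open>Endomorphisms of the presented groups\<close>

locale p_cubed_presentation = p_cubed_group +
  fixes a b and s :: nat
  assumes a_closed [simp]: "a \<in> carrier G" and b_closed [simp]: "b \<in> carrier G"
    and b_pow_p: "b [^] p = \<one>"
    and ba: "b \<otimes> a = a [^] s \<otimes> b" and s_cong: "[s = 1] (mod p)"
    and surj: "x \<in> carrier G \<Longrightarrow> \<exists>(i::nat) (j::nat). x = a [^] i \<otimes> b [^] j"
begin

text \<open>
  There are only \<open>p\<^sup>3\<close> reduced exponent pairs for the \<open>p\<^sup>3\<close> elements, so the surjection from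
  pairs to elements is injective.
\<close>

lemma normal_form_unique:
  fixes i j k l :: nat
  assumes eq: "a [^] i \<otimes> b [^] j = a [^] k \<otimes> b [^] l"
  shows "[i = k] (mod p\<^sup>2) \<and> [j = l] (mod p)"
proof -
  let ?f = "\<lambda>(i, j). a [^] i \<otimes> b [^] j" and ?A = "{..<p\<^sup>2} \<times> {..<p}"
  have red: "a [^] i \<otimes> b [^] j = ?f (i mod p\<^sup>2, j mod p)" for i j :: nat
    using pow_cong[OF a_closed pow_p2, of i "i mod p\<^sup>2"] pow_cong[OF b_closed b_pow_p, of j "j mod p"]
    by simp
  have "?f ` ?A = carrier G"
  proof
    show "carrier G \<subseteq> ?f ` ?A"
    proof
      fix x assume "x \<in> carrier G"
      then obtain i j :: nat where "x = a [^] i \<otimes> b [^] j" using surj by blast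
      then have "x = ?f (i mod p\<^sup>2, j mod p)" by (rule trans[OF _ red])
      then show "x \<in> ?f ` ?A" by (rule image_eqI) simp
    qed
  qed auto
  then have "inj_on ?f ?A"
    using order_G by (intro eq_card_imp_inj_on)
      (simp_all add: order_def power2_eq_square power3_eq_cube)
  moreover have "?f (i mod p\<^sup>2, j mod p) = ?f (k mod p\<^sup>2, l mod p)"
    by (rule trans[OF trans[OF red[symmetric] eq] red])
  ultimately have "(i mod p\<^sup>2, j mod p) = (k mod p\<^sup>2, l mod p)"
    by (rule inj_onD) simp_all
  then show ?thesis by (simp add: cong_def)
qed

text \<open>
  The universal property of the presentation.
\<close>

lemma ex_hom:
  assumes c: "c \<in> carrier G" "d \<in> carrier G" "d [^] p = \<one>" "d \<otimes> c = c [^] s \<otimes> d"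
  obtains f where "f \<in> hom G G" "\<And>(i::nat) (j::nat). f (a [^] i \<otimes> b [^] j) = c [^] i \<otimes> d [^] j"
proof -
  define f where "f x = (SOME y. \<exists>(i::nat) (j::nat). x = a [^] i \<otimes> b [^] j \<and> y = c [^] i \<otimes> d [^] j)" for x
  have f: "f (a [^] i \<otimes> b [^] j) = c [^] i \<otimes> d [^] j" for i j :: nat
    unfolding f_def
  proof (rule some_equality)
    fix y
    assume "\<exists>(k::nat) (l::nat). a [^] i \<otimes> b [^] j = a [^] k \<otimes> b [^] l \<and> y = c [^] k \<otimes> d [^] l"
    then obtain k l :: nat where "a [^] i \<otimes> b [^] j = a [^] k \<otimes> b [^] l" and y: "y = c [^] k \<otimes> d [^] l"
      by blast
    then have "[i = k] (mod p\<^sup>2) \<and> [j = l] (mod p)" by (intro normal_form_unique)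
    then show "y = c [^] i \<otimes> d [^] j"
      using y c pow_cong[OF c(1) pow_p2[OF c(1)], of i k] pow_cong[OF c(2,3), of j l] by simp
  qed auto
  have "f (x \<otimes> y) = f x \<otimes> f y" if x: "x \<in> carrier G" and y: "y \<in> carrier G" for x y
  proof -
    obtain i j :: nat where "x = a [^] i \<otimes> b [^] j" using surj[OF x] by blast
    moreover obtain k l :: nat where "y = a [^] k \<otimes> b [^] l" using surj[OF y] by blast
    ultimately show ?thesis
      by (simp only: f metacyclic_mult[OF a_closed b_closed ba] metacyclic_mult[OF c(1,2,4)])
  qed
  moreover have "f x \<in> carrier G" if "x \<in> carrier G" for x
    using surj[OF that] f c by auto
  ultimately have "f \<in> hom G G" by (simp add: hom_def)
  with f show thesis by (rule that[rotated])
qed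

lemma pow_p: "(a [^] (i::nat) \<otimes> b [^] (j::nat)) [^] p = a [^] (i * p)"
proof -
  have "b [^] (j * p) = (b [^] p) [^] j" by (simp add: nat_pow_pow mult.commute)
  then have "b [^] (j * p) = \<one>" by (simp add: b_pow_p)
  then show ?thesis using metacyclic_pow_p[OF a_closed b_closed ba s_cong] by simp
qed

lemma pow_p_eq_one_iff: "(a [^] (i::nat) \<otimes> b [^] (j::nat)) [^] p = \<one> \<longleftrightarrow> p dvd i"
proof -
  have "a [^] (i * p) = \<one> \<longleftrightarrow> [i * p = 0] (mod p\<^sup>2)"
    using normal_form_unique[of "i * p" 0 0 0] pow_cong[OF a_closed pow_p2, of "i * p" 0] by auto
  then show ?thesis by (simp add: pow_p cong_0_iff power2_eq_square)
qed

text \<open>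
  Write \<open>s = 1 + p m\<close>. For \<open>x = a\<^sup>i b\<^sup>j\<close> the factor \<open>(x\<^sup>p)\<^sup>m = a\<^sup>i\<^sup>p\<^sup>m\<close> of \<open>x\<^sup>s\<close> commutes with \<open>b\<close>,
  since \<open>s \<equiv> 1\<close> modulo \<open>p\<close>; so \<open>x\<^sup>s = a\<^sup>i\<^sup>s b\<^sup>j\<close>, which is also the conjugate of \<open>x\<close> by \<open>b\<close>.
\<close>

lemma b_mult_commute:
  assumes "x \<in> carrier G"
  shows "b \<otimes> x = x [^] s \<otimes> b"
proof -
  obtain i j :: nat where x: "x = a [^] i \<otimes> b [^] j" using surj[OF assms] by blast
  obtain m where m: "s = 1 + p * m"
    using s_cong prime_gt_1_nat[OF prime_p]
    by (metis cong_def cong_le_nat mod_less mod_less_eq_dividend mult.commute add.commute cong_sym)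
  have cong: "[i * p * m * s ^ j = i * p * m] (mod p\<^sup>2)"
  proof -
    have "[s ^ j = 1] (mod p)" using cong_pow[OF s_cong, of j] by simp
    then have "[p * s ^ j = p * 1] (mod p * p)" by (simp add: cong_def mult_mod_right)
    from cong_scalar_left[OF this, of "i * m"] show ?thesis
      by (simp add: power2_eq_square ac_simps)
  qed
  have "x [^] s = x \<otimes> (x [^] p) [^] m"
    using assms nat_pow_mult[OF assms, of 1 "p * m"] by (simp add: m nat_pow_pow)
  also have "\<dots> = (a [^] i \<otimes> b [^] j) \<otimes> (a [^] (i * p * m) \<otimes> b [^] (0::nat))"
    by (simp add: x pow_p nat_pow_pow)
  also have "\<dots> = a [^] (i + i * p * m * s ^ j) \<otimes> b [^] j"
    using metacyclic_mult[OF a_closed b_closed ba, of i j "i * p * m" 0] by simp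
  also have "a [^] (i + i * p * m * s ^ j) = a [^] (i * s)"
    using cong by (intro pow_cong[OF a_closed pow_p2]) (simp_all add: m cong_add_lcancel_nat distrib_left mult.assoc)
  finally have "x [^] s \<otimes> b = a [^] (i * s) \<otimes> b [^] Suc j" by (simp add: m_assoc)
  moreover have "b \<otimes> x = a [^] (i * s) \<otimes> b [^] Suc j"
    using metacyclic_mult[OF a_closed b_closed ba, of 0 1 i j] by (simp add: x)
  ultimately show ?thesis by simp
qed

text \<open>
  With \<open>x = a\<^sup>i b\<^sup>j\<close> and \<open>i\<close> prime to \<open>p\<close>, the element \<open>a\<close> is a power of \<open>a\<^sup>i = x b\<^sup>(\<^sup>p\<^sup>-\<^sup>1\<^sup>)\<^sup>j\<close>, and powers
  of such products are again of the form \<open>x\<^sup>u b\<^sup>v\<close>.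
\<close>

lemma change_generator:
  assumes x: "x \<in> carrier G" "x [^] p \<noteq> \<one>"
  shows "p_cubed_presentation G p x b s"
proof unfold_locales
  fix y assume "y \<in> carrier G"
  then obtain k l :: nat where y: "y = a [^] k \<otimes> b [^] l" using surj by blast
  obtain i j :: nat where xij: "x = a [^] i \<otimes> b [^] j" using surj x by blast
  then have "\<not> p dvd i" using x pow_p_eq_one_iff by simp
  then obtain i' where i': "[i * i' = 1] (mod p\<^sup>2)" by (rule inverse_mod_p2)
  have "b [^] j \<otimes> b [^] ((p - 1) * j) = b [^] (p * j)"
    using p_pos by (cases p) (simp_all add: nat_pow_mult)
  also have "\<dots> = \<one>" using b_pow_p by (simp flip: nat_pow_pow)
  finally have "x \<otimes> b [^] ((p - 1) * j) = a [^] i"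
    by (simp add: xij m_assoc)
  moreover have "(a [^] i) [^] (i' * k) = a [^] k"
  proof -
    have "[i * (i' * k) = k] (mod p\<^sup>2)" using cong_scalar_right[OF i', of k] by (simp add: mult.assoc)
    then show ?thesis using pow_cong[OF a_closed pow_p2] by (simp add: nat_pow_pow)
  qed
  ultimately have "(x [^] (1::nat) \<otimes> b [^] ((p - 1) * j)) [^] (i' * k) = a [^] k" using x by simp
  then obtain u v :: nat where "a [^] k = x [^] u \<otimes> b [^] v"
    using metacyclic_pow[OF x(1) b_closed b_mult_commute[OF x(1)]] by metis
  then have "y = x [^] u \<otimes> b [^] (v + l)" using x by (simp add: y m_assoc nat_pow_mult)
  then show "\<exists>(i::nat) (j::nat). y = x [^] i \<otimes> b [^] j" by blast
qed (use x b_mult_commute b_pow_p s_cong in auto)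

text \<open>
  The pairs \<open>(x, b)\<close> and \<open>(y, b)\<close> satisfy the same relations, by \<open>b_mult_commute\<close>, and the
  first one generates the group.
\<close>

lemma hom_from_order_p2:
  assumes x: "x \<in> carrier G" "x [^] p \<noteq> \<one>" and y: "y \<in> carrier G"
  obtains f where "f \<in> hom G G" "f x = y"
proof -
  interpret X: p_cubed_presentation G p x b s using x by (rule change_generator)
  obtain f where f: "f \<in> hom G G" "\<And>(i::nat) (j::nat). f (x [^] i \<otimes> b [^] j) = y [^] i \<otimes> b [^] j"
    using X.ex_hom[OF y b_closed b_pow_p b_mult_commute[OF y]] by blast
  have "f x = y" using f(2)[of 1 0] x y by simp
  with f(1) show thesis by (rule that)
qed

text \<open>
  Here \<open>x = a\<^sup>p\<^sup>k b\<^sup>j\<close> with \<open>j\<close> prime to \<open>p\<close>; the endomorphism kills \<open>a\<close> and sends \<open>b\<close> to the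
  power of \<open>y\<close> whose exponent is inverse to \<open>j\<close>.
\<close>

lemma hom_from_order_p:
  assumes x: "x \<in> carrier G" "x [^] p = \<one>" "x \<notin> (\<lambda>z. z [^] p) ` carrier G"
    and y: "y \<in> carrier G" "y [^] p = \<one>"
  obtains f where "f \<in> hom G G" "f x = y"
proof -
  obtain i j :: nat where xij: "x = a [^] i \<otimes> b [^] j" using surj x by blast
  then obtain i0 where i: "i = i0 * p" using x pow_p_eq_one_iff by (metis dvd_def mult.commute)
  have "\<not> p dvd j"
  proof
    assume "p dvd j"
    then have "b [^] j = \<one>" using pow_cong[OF b_closed b_pow_p, of j 0] by (simp add: cong_0_iff)
    then have "x = (a [^] i0) [^] p" using xij i by (simp add: nat_pow_pow)
    then show False using x by auto
  qed
  then obtain j' where j': "[j * j' = 1] (mod p\<^sup>2)" by (rule inverse_mod_p2)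
  have "(y [^] j') [^] p = \<one>"
    using y by (simp add: nat_pow_pow mult.commute[of j']) (simp flip: nat_pow_pow)
  then obtain f where f: "f \<in> hom G G"
      "\<And>(i::nat) (j::nat). f (a [^] i \<otimes> b [^] j) = \<one> [^] i \<otimes> (y [^] j') [^] j"
    using ex_hom[of \<one> "y [^] j'"] y by auto
  have "f x = y [^] (j * j')" using f y by (simp add: xij nat_pow_pow mult.commute)
  also have "\<dots> = y [^] (1::nat)" using j' by (intro pow_cong[OF y(1) pow_p2[OF y(1)]])
  finally have "f x = y" using y by simp
  with f(1) show thesis by (rule that)
qed

lemma card_pow_p_eq_one: "card {x \<in> carrier G. x [^] p = \<one>} = p\<^sup>2"
proof -
  let ?f = "\<lambda>(i, j). a [^] (i * p) \<otimes> b [^] j" and ?A = "{..<p} \<times> {..<p}"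
  have "{x \<in> carrier G. x [^] p = \<one>} = ?f ` ?A"
  proof (intro equalityI subsetI)
    fix x assume x: "x \<in> {x \<in> carrier G. x [^] p = \<one>}"
    then obtain i j :: nat where xij: "x = a [^] i \<otimes> b [^] j" using surj by blast
    then have "p dvd i" using x pow_p_eq_one_iff by simp
    then obtain k where k: "i = k * p" by (metis dvd_def mult.commute)
    have "a [^] i = a [^] (k mod p * p)"
      by (rule pow_cong[OF a_closed pow_p2]) (simp_all add: k cong_def power2_eq_square mult_mod_left)
    moreover have "b [^] j = b [^] (j mod p)" by (rule pow_cong[OF b_closed b_pow_p]) simp
    ultimately have "x = ?f (k mod p, j mod p)" by (simp add: xij)
    then show "x \<in> ?f ` ?A" by (rule image_eqI) simp
  qed (auto simp: pow_p_eq_one_iff)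
  moreover have "inj_on ?f ?A"
  proof (rule inj_onI, clarify)
    fix i j k l assume lt: "i < p" "j < p" "k < p" "l < p"
      and "a [^] (i * p) \<otimes> b [^] j = a [^] (k * p) \<otimes> b [^] l"
    then have "[i * p = k * p] (mod p\<^sup>2) \<and> [j = l] (mod p)" by (intro normal_form_unique)
    then show "i = k \<and> j = l" using lt by (simp add: cong_def power2_eq_square flip: mult_mod_left)
  qed
  ultimately show ?thesis by (simp add: card_image power2_eq_square)
qed

lemma card_p_powers: "card ((\<lambda>x. x [^] p) ` carrier G) = p"
proof -
  have "(\<lambda>x. x [^] p) ` carrier G = (\<lambda>i. a [^] (i * p)) ` {..<p}"
  proof (intro equalityI subsetI)
    fix y assume "y \<in> (\<lambda>x. x [^] p) ` carrier G"
    then obtain x where x: "x \<in> carrier G" "y = x [^] p" by blast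
    then obtain i j :: nat where "x = a [^] i \<otimes> b [^] j" using surj by blast
    then have "y = a [^] (i * p)" using x pow_p by simp
    also have "\<dots> = a [^] (i mod p * p)"
      by (rule pow_cong[OF a_closed pow_p2]) (simp_all add: cong_def power2_eq_square mult_mod_left)
    finally show "y \<in> (\<lambda>i. a [^] (i * p)) ` {..<p}" by (rule image_eqI) simp
  next
    fix y assume "y \<in> (\<lambda>i. a [^] (i * p)) ` {..<p}"
    then show "y \<in> (\<lambda>x. x [^] p) ` carrier G" by (auto simp flip: nat_pow_pow)
  qed
  moreover have "inj_on (\<lambda>i. a [^] (i * p)) {..<p}"
  proof (rule inj_onI)
    fix i k assume lt: "i \<in> {..<p}" "k \<in> {..<p}" and "a [^] (i * p) = a [^] (k * p)"
    then have "[i * p = k * p] (mod p\<^sup>2)" using normal_form_unique[of "i * p" 0 "k * p" 0] by simp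
    then show "i = k" using lt by (simp add: cong_def power2_eq_square flip: mult_mod_left)
  qed
  ultimately show ?thesis by (simp add: card_image)
qed

text \<open>
  A nontrivial \<open>p\<close>-th power \<open>u\<^sup>p\<close> reaches any other \<open>p\<close>-th power \<open>v\<^sup>p\<close>, because some
  endomorphism maps \<open>u\<close> to \<open>v\<close>.
\<close>

lemma endo_chain_p_cubed:
  "endo_chain G 3 ((!) [{\<one>}, (\<lambda>x. x [^] p) ` carrier G, {x \<in> carrier G. x [^] p = \<one>}, carrier G])"
proof -
  let ?P = "(\<lambda>x. x [^] p) ` carrier G"
  have all_le_3: "(\<forall>k\<le>3. Q k) \<longleftrightarrow> Q 0 \<and> Q 1 \<and> Q 2 \<and> Q 3" for Q :: "nat \<Rightarrow> bool"
    by (auto simp: numeral_3_eq_3 numeral_2_eq_2 le_Suc_eq)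
  have all_less_3: "(\<forall>k<3. Q k) \<longleftrightarrow> Q 0 \<and> Q 1 \<and> Q 2" for Q :: "nat \<Rightarrow> bool"
    by (auto simp: numeral_3_eq_3 numeral_2_eq_2 less_Suc_eq)
  have reach: "(\<exists>f \<in> hom G G. f x = y) \<longleftrightarrow>
      (x = \<one> \<longrightarrow> y = \<one>) \<and> (x \<in> ?P \<longrightarrow> y \<in> ?P) \<and> (x [^] p = \<one> \<longrightarrow> y [^] p = \<one>)"
    if x: "x \<in> carrier G" and y: "y \<in> carrier G" for x y
  proof
    assume "\<exists>f \<in> hom G G. f x = y"
    then obtain f where f: "f \<in> hom G G" "f x = y" by blast
    interpret f: group_hom G G f by unfold_locales (rule f)
    show "(x = \<one> \<longrightarrow> y = \<one>) \<and> (x \<in> ?P \<longrightarrow> y \<in> ?P) \<and> (x [^] p = \<one> \<longrightarrow> y [^] p = \<one>)"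
    proof (intro conjI impI)
      assume "x \<in> ?P"
      then show "y \<in> ?P" using f(2) by (auto simp: f.hom_nat_pow)
    next
      assume "x [^] p = \<one>"
      then show "y [^] p = \<one>" using x f(2) f.hom_nat_pow[of x p] by simp
    qed (use f(2) in simp)
  next
    assume inv: "(x = \<one> \<longrightarrow> y = \<one>) \<and> (x \<in> ?P \<longrightarrow> y \<in> ?P) \<and> (x [^] p = \<one> \<longrightarrow> y [^] p = \<one>)"
    consider "x [^] p \<noteq> \<one>" | "x [^] p = \<one>" "x \<notin> ?P" | "x \<in> ?P" "x \<noteq> \<one>" | "x = \<one>" by blast
    then show "\<exists>f \<in> hom G G. f x = y"
    proof cases
      case 1
      then show ?thesis using hom_from_order_p2[OF x _ y] by blast
    next
      case 2
      then show ?thesis using hom_from_order_p[OF x _ _ y] inv by blast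
    next
      case 3
      then obtain u v where u: "u \<in> carrier G" "x = u [^] p" and v: "v \<in> carrier G" "y = v [^] p"
        using inv by blast
      then obtain f where f: "f \<in> hom G G" "f u = v"
        using hom_from_order_p2[OF u(1) _ v(1)] 3 by blast
      then have "f x = y" using u v hom_nat_pow[of f G G u p] by (simp add: is_group)
      with f(1) show ?thesis by blast
    next
      case 4
      then have "id x = y" using inv by simp
      moreover have "id \<in> hom G G" by (simp add: hom_def)
      ultimately show ?thesis by blast
    qed
  qed
  have "?P \<subseteq> {x \<in> carrier G. x [^] p = \<one>}"
    using pow_p2 by (auto simp: nat_pow_pow power2_eq_square)
  moreover have "\<one> \<in> ?P" by (rule image_eqI[of _ _ \<one>]) simp_all
  ultimately show ?thesis
    unfolding endo_chain_def all_le_3 all_less_3 using reach finite_carrier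
    by (simp add: numeral_3_eq_3 numeral_2_eq_2)
qed

end

lemma (in p_cubed_group) ex_endo_chain:
  assumes a: "a \<in> carrier G" "a [^] p \<noteq> \<one>"
  shows "\<exists>S. endo_chain G 3 S \<and> (\<forall>k\<le>3. card (S k) = p ^ k)"
proof -
  obtain b and s :: nat where b: "b \<in> carrier G" "b [^] p = \<one>" "b \<otimes> a = a [^] s \<otimes> b" "[s = 1] (mod p)"
    "\<And>x. x \<in> carrier G \<Longrightarrow> \<exists>(i::nat) (j::nat). x = a [^] i \<otimes> b [^] j"
    using metacyclic_presentation[OF a] by blast
  interpret p_cubed_presentation G p a b s
    using a b by unfold_locales
  let ?S = "(!) [{\<one>}, (\<lambda>x. x [^] p) ` carrier G, {x \<in> carrier G. x [^] p = \<one>}, carrier G]"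
  have "card (?S k) = p ^ k" if "k \<le> 3" for k
  proof -
    have "k = 0 \<or> k = 1 \<or> k = 2 \<or> k = 3" using that by linarith
    then show ?thesis
      by (elim disjE) (use order_G in \<open>simp_all add: card_p_powers card_pow_p_eq_one order_def numeral_3_eq_3\<close>)
  qed
  with endo_chain_p_cubed show ?thesis by blast
qed

section \<open>The three groups\<close>

lemma DirProd_nat_pow:
  "(x, y) [^]\<^bsub>G \<times>\<times> H\<^esub> (n::nat) = (x [^]\<^bsub>G\<^esub> n, y [^]\<^bsub>H\<^esub> n)"
  by (induction n) simp_all

lemma p_cubed_group_DirProd:
  fixes p :: nat
  assumes "prime p" "odd p"
  shows "p_cubed_group (integer_mod_group (p\<^sup>2) \<times>\<times> integer_mod_group p) p"
proof -
  have p0: "0 < p" using assms by (simp add: prime_gt_0_nat)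
  interpret group "integer_mod_group (p\<^sup>2) \<times>\<times> integer_mod_group p"
    by (intro DirProd_group group_integer_mod_group)
  show ?thesis
  proof unfold_locales
    show "order (integer_mod_group (p\<^sup>2) \<times>\<times> integer_mod_group p) = p ^ 3"
      using p0 by (simp add: order_def carrier_integer_mod_group card_cartesian_product
          power2_eq_square power3_eq_cube flip: of_nat_mult)
    fix x assume "x \<in> carrier (integer_mod_group (p\<^sup>2) \<times>\<times> integer_mod_group p)"
    show "x [^]\<^bsub>integer_mod_group (p\<^sup>2) \<times>\<times> integer_mod_group p\<^esub> p\<^sup>2
        = \<one>\<^bsub>integer_mod_group (p\<^sup>2) \<times>\<times> integer_mod_group p\<^esub>"
      by (cases x) (simp add: DirProd_nat_pow power2_eq_square mult.assoc)
  qed (use assms in auto)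
qed

lemma (in group) group_exponentD:
  assumes "finite (carrier G)"
  shows pow_group_exponent: "x \<in> carrier G \<Longrightarrow> x [^] group_exponent G = \<one>"
    and group_exponent_le: "0 < n \<Longrightarrow> (\<And>x. x \<in> carrier G \<Longrightarrow> x [^] n = \<one>) \<Longrightarrow> group_exponent G \<le> n"
proof -
  have "0 < order G \<and> (\<forall>x \<in> carrier G. x [^] order G = \<one>)"
    using assms by (simp add: order_gt_0_iff_finite pow_order_eq_1)
  then have "0 < group_exponent G \<and> (\<forall>x \<in> carrier G. x [^] group_exponent G = \<one>)"
    unfolding group_exponent_def by (rule LeastI)
  then show "x \<in> carrier G \<Longrightarrow> x [^] group_exponent G = \<one>" by blast
  show "0 < n \<Longrightarrow> (\<And>x. x \<in> carrier G \<Longrightarrow> x [^] n = \<one>) \<Longrightarrow> group_exponent G \<le> n"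
    unfolding group_exponent_def by (rule Least_le) simp
qed

theorem proposition9p1:
  fixes p :: nat
  assumes "prime p" and "odd p"
  shows "digraph_iso (endo_digraph (integer_mod_group (p ^ 3)))
           (endo_digraph (integer_mod_group (p ^ 2) \<times>\<times> integer_mod_group p)) \<and>
         (\<forall>G :: ('a, 'm) monoid_scheme.
            group G \<and> \<not> comm_group G \<and> order G = p ^ 3 \<and> group_exponent G = p ^ 2 \<longrightarrow>
              digraph_iso (endo_digraph (integer_mod_group (p ^ 3))) (endo_digraph G) \<and>
              digraph_iso (endo_digraph (integer_mod_group (p ^ 2) \<times>\<times> integer_mod_group p))
                (endo_digraph G))"
proof -
  let ?C = "integer_mod_group (p ^ 3)" and ?A = "integer_mod_group (p ^ 2) \<times>\<times> integer_mod_group p"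
  have p1: "1 < p" using assms(1) by (rule prime_gt_1_nat)
  have C: "endo_chain ?C 3 (multiples_chain p 3)" "\<And>k. k \<le> 3 \<Longrightarrow> card (multiples_chain p 3 k) = p ^ k"
    using p1 by (simp_all add: endo_chain_integer_mod_group assms(1) card_multiples_chain)
  have A: "p_cubed_group ?A p" by (rule p_cubed_group_DirProd[OF assms])
  have less: "p < p ^ 2" using p1 by (simp add: power2_eq_square)
  have "(1, 0) \<in> carrier ?A" using p1 by simp
  moreover have "(1, 0) [^]\<^bsub>?A\<^esub> p \<noteq> \<one>\<^bsub>?A\<^esub>"
    using p1 less by (simp add: DirProd_nat_pow flip: of_nat_power)
  ultimately obtain S where S: "endo_chain ?A 3 S" "\<And>k. k \<le> 3 \<Longrightarrow> card (S k) = p ^ k"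
    using p_cubed_group.ex_endo_chain[OF A] by blast
  have "digraph_iso (endo_digraph ?C) (endo_digraph ?A)"
    by (rule endo_chain_imp_digraph_iso[OF C(1) S(1)]) (simp add: C(2) S(2))
  moreover have "digraph_iso (endo_digraph ?C) (endo_digraph G) \<and> digraph_iso (endo_digraph ?A) (endo_digraph G)"
    if G: "group G" "order G = p ^ 3" "group_exponent G = p ^ 2" for G :: "('a, 'm) monoid_scheme"
  proof -
    interpret group G by (rule G)
    have fin: "finite (carrier G)" using G p1 order_gt_0_iff_finite by simp
    have pG: "p_cubed_group G p"
      using assms G(2) pow_group_exponent[OF fin] G(3) by unfold_locales auto
    obtain a where a: "a \<in> carrier G" "a [^]\<^bsub>G\<^esub> p \<noteq> \<one>\<^bsub>G\<^esub>"
      using group_exponent_le[OF fin, of p] p1 less G(3) by fastforce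
    obtain T where T: "endo_chain G 3 T" "\<And>k. k \<le> 3 \<Longrightarrow> card (T k) = p ^ k"
      using p_cubed_group.ex_endo_chain[OF pG a] by blast
    show ?thesis
      using endo_chain_imp_digraph_iso[OF C(1) T(1)] endo_chain_imp_digraph_iso[OF S(1) T(1)]
      by (simp add: C(2) S(2) T(2))
  qed
  ultimately show ?thesis by blast
qed

end
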